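(* Let $R$ be an associative ring with identity, let $n\ge 1$, and let $x_1,\dots,x_n\in R$ be distinct. Put $R_1(x)=x-x_1\in R[x]$, and for $i=1,\dots,n-1$, whenever $R_i(x_{i+1})$ is an invertible element of $R$, define recursively $$R_{i+1}(x)=\left(x-R_i(x_{i+1})\,x_{i+1}\,\bigl(R_i(x_{i+1})\bigr)^{-1}\right)R_i(x).$$ If for every $i=1,\dots,n-1$ the element $R_i(x_{i+1})$ is invertible in $R$ (so that all of $R_1(x),\dots,R_n(x)$ are defined), then $R_n(x_i)=0$ for every $i=1,\dots,n$. In other words, under this invertibility condition there exists a polynomial in $R[x]$ of degree $n$ such that $x_1,\dots,x_n$ are its roots.
   Context: $R$ is an associative, not necessarily commutative, ring with identity ($1\neq 0$). $R[x]$ is the ring of polynomials $P(x)=a_nx^n+\dots+a_1x+a_0$ with $a_k\in R$, where the variable $x$ commutes with the coefficients; addition is coefficientwise, and the product of $\sum_i a_ix^i$ and $\sum_j b_jx^j$ is $\sum_k c_kx^k$ with $c_k=\sum_{i+j=k}a_ib_j$. The degree of $P(x)$ is $n$ if $a_n\ne 0$. For $a\in R$, evaluation is with coefficients on the left: $P(a)=a_na^n+a_{n-1}a^{n-1}+\dots+a_1a+a_0$. (Evaluation is in general not multiplicative.) An element $a\in R$ is a (right) root of $P(x)$ if $P(a)=0$; "the roots of $P$ are $x_1,\dots,x_n$" only means that each $x_i$ is a root, not that there are no others. *)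

theory Defs
  imports "HOL-Algebra.UnivPoly"
begin

(* UP R is the polynomial ring over an arbitrary, possibly noncommutative, ring R:
   its product is the convolution, i.e. the indeterminate commutes with the coefficients.
   eval R R id a P is the sum over i of coeff P i times a^i, coefficients on the left. *)

definition poly_at :: "('a, 'm) ring_scheme \<Rightarrow> (nat \<Rightarrow> 'a) \<Rightarrow> 'a \<Rightarrow> 'a"
  where "poly_at R P a = eval R R id a P"

definition right_root :: "('a, 'm) ring_scheme \<Rightarrow> (nat \<Rightarrow> 'a) \<Rightarrow> 'a \<Rightarrow> bool"
  where "right_root R P a \<longleftrightarrow> a \<in> carrier R \<and> poly_at R P a = \<zero>\<^bsub>R\<^esub>"

definition x_minus :: "('a, 'm) ring_scheme \<Rightarrow> 'a \<Rightarrow> (nat \<Rightarrow> 'a)"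
  where "x_minus R c = monom (UP R) \<one>\<^bsub>R\<^esub> 1 \<ominus>\<^bsub>UP R\<^esub> monom (UP R) c 0"

(* The points x 1, x 2, ... and the polynomials are indexed from 1; the value at index 0
   is arbitrary and never used. The step from i to i + 1 is meaningful only if
   poly_at R (iter_poly R x i) (x (i + 1)) is a unit of R. *)

fun iter_poly :: "('a, 'm) ring_scheme \<Rightarrow> (nat \<Rightarrow> 'a) \<Rightarrow> nat \<Rightarrow> (nat \<Rightarrow> 'a)"
  where
    "iter_poly R x 0 = undefined"
  | "iter_poly R x (Suc 0) = x_minus R (x 1)"
  | "iter_poly R x (Suc (Suc i)) =
       (let P = iter_poly R x (Suc i); y = x (Suc (Suc i)); v = poly_at R P y
        in x_minus R (v \<otimes>\<^bsub>R\<^esub> y \<otimes>\<^bsub>R\<^esub> inv\<^bsub>R\<^esub> v) \<otimes>\<^bsub>UP R\<^esub> P)"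

end

theory Submission
  imports Defs
begin

text \<open>
  Left evaluation is not multiplicative, but multiplication by a linear factor on the left is
  still under control: since the indeterminate commutes with the coefficients,
  \<open>((x - c) p)(a) = p(a) a - c p(a)\<close> (\<open>poly_at_x_minus_mult\<close>). The same formula gives both halves of the induction step.
  Every root of \<open>p\<close> remains a root of \<open>(x - c) p\<close>, because both terms
  contain the factor \<open>p(a)\<close> (\<open>right_root_x_minus_mult\<close>). If \<open>v =
  p(a)\<close> is a unit, then \<open>c = v a v\<^sup>-\<^sup>1\<close> makes \<open>c v = v
  a\<close>, so that \<open>a\<close> becomes a root as well
  (\<open>right_root_conjugate_x_minus_mult\<close>): a root of \<open>p\<close> is not moved, and
  a non-root has to be conjugated by the value of \<open>p\<close> before it can be used in the
  new factor.

  All factors are monic, so that the leading coefficient of the product is \<open>1\<close> and the degree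
  does not drop in the presence of zero divisors (\<open>monic_x_minus_mult\<close>).
\<close>

context UP_ring
begin

text \<open>
  The degree of a sum or scalar multiple may drop, so the comparison of values of different polynomials
  requires a common upper summation bound.
\<close>

lemma poly_at_eq_finsum:
  assumes p: "p \<in> carrier P" and a: "a \<in> carrier R" and le: "deg R p \<le> N"
  shows "poly_at R p a = (\<Oplus>i\<in>{..N}. coeff P p i \<otimes> a [^] i)"
proof -
  have "(\<Oplus>i\<in>{..deg R p}. coeff P p i \<otimes> a [^] i) = (\<Oplus>i\<in>{..N}. coeff P p i \<otimes> a [^] i)"
    using p a le by (intro R.add.finprod_mono_neutral_cong_left) (auto simp: deg_aboveD)
  then show ?thesis
    using p by (simp add: poly_at_def eval_on_carrier)
qed

lemma poly_at_closed [simp]: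
  assumes "p \<in> carrier P" "a \<in> carrier R"
  shows "poly_at R p a \<in> carrier R"
  using assms by (simp add: poly_at_eq_finsum[OF assms order_refl] Pi_def)

lemma poly_at_one:
  assumes "a \<in> carrier R"
  shows "poly_at R \<one>\<^bsub>P\<^esub> a = \<one>"
  using assms by (simp add: poly_at_eq_finsum[where N = 0])

lemma poly_at_add:
  assumes p: "p \<in> carrier P" and q: "q \<in> carrier P" and a: "a \<in> carrier R"
  shows "poly_at R (p \<oplus>\<^bsub>P\<^esub> q) a = poly_at R p a \<oplus> poly_at R q a"
proof -
  define N where "N = max (deg R p) (deg R q)"
  have "deg R (p \<oplus>\<^bsub>P\<^esub> q) \<le> N" "deg R p \<le> N" "deg R q \<le> N"
    using p q by (simp_all add: N_def)
  then show ?thesis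
    using p q a by (simp add: poly_at_eq_finsum[where N = N] R.l_distr R.finsum_addf Pi_def)
qed

lemma poly_at_smult:
  assumes c: "c \<in> carrier R" and p: "p \<in> carrier P" and a: "a \<in> carrier R"
  shows "poly_at R (c \<odot>\<^bsub>P\<^esub> p) a = c \<otimes> poly_at R p a"
  using assms deg_smult_decr[OF c p]
  by (simp add: poly_at_eq_finsum[where N = "deg R p"] R.finsum_rdistr R.m_assoc Pi_def)

lemma coeff_X_mult:
  assumes "p \<in> carrier P"
  shows "coeff P (monom P \<one> 1 \<otimes>\<^bsub>P\<^esub> p) k = (if k = 0 then \<zero> else coeff P p (k - 1))"
  using coeff_monom_mult[OF R.one_closed assms, of 1] assms
  by (cases k) simp_all

text \<open>
  Commuting with the coefficients, the indeterminate shifts them when it multiplies from the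
  left, yet under evaluation it turns into a factor \<open>a\<close> on the right of \<open>p(a)\<close>. This is where
  evaluation fails to be multiplicative.
\<close>

lemma poly_at_X_mult:
  assumes p: "p \<in> carrier P" and a: "a \<in> carrier R"
  shows "poly_at R (monom P \<one> 1 \<otimes>\<^bsub>P\<^esub> p) a = poly_at R p a \<otimes> a"
proof -
  define d where "d = deg R p"
  have "deg R (monom P \<one> 1 \<otimes>\<^bsub>P\<^esub> p) \<le> Suc d"
    using p by (intro deg_aboveI) (simp_all add: coeff_X_mult deg_aboveD d_def del: coeff_mult One_nat_def)
  then have "poly_at R (monom P \<one> 1 \<otimes>\<^bsub>P\<^esub> p) a
      = (\<Oplus>i\<in>{..Suc d}. coeff P (monom P \<one> 1 \<otimes>\<^bsub>P\<^esub> p) i \<otimes> a [^] i)"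
    using p a by (intro poly_at_eq_finsum) simp_all
  also have "\<dots> = (\<Oplus>i\<in>{..d}. coeff P p i \<otimes> a [^] i \<otimes> a)"
    using p a
    by (subst R.finsum_Suc2)
      (simp_all add: coeff_X_mult R.m_assoc Pi_def del: coeff_mult R.finsum_Suc One_nat_def)
  also have "\<dots> = poly_at R p a \<otimes> a"
    using p a by (simp add: poly_at_eq_finsum[where N = d] d_def R.finsum_ldistr Pi_def)
  finally show ?thesis .
qed

lemma x_minus_closed [simp]:
  assumes "c \<in> carrier R"
  shows "x_minus R c \<in> carrier P"
  using assms by (simp add: x_minus_def P_def[symmetric])

text \<open>
  Evaluation is additive and compatible with scalars on the left, so this splitting reduces the
  evaluation of the product to that of \<open>x p\<close>.
\<close>

lemma x_minus_mult:
  assumes "c \<in> carrier R" "p \<in> carrier P"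
  shows "x_minus R c \<otimes>\<^bsub>P\<^esub> p = monom P \<one> 1 \<otimes>\<^bsub>P\<^esub> p \<oplus>\<^bsub>P\<^esub> (\<ominus> c) \<odot>\<^bsub>P\<^esub> p"
proof -
  have "x_minus R c = monom P \<one> 1 \<oplus>\<^bsub>P\<^esub> monom P (\<ominus> c) 0"
    using assms by (simp add: x_minus_def a_minus_def P_def[symmetric])
  then show ?thesis
    using assms by (simp add: UP_l_distr monom_mult_is_smult del: monom_a_inv)
qed

lemma poly_at_x_minus_mult:
  assumes "c \<in> carrier R" "p \<in> carrier P" "a \<in> carrier R"
  shows "poly_at R (x_minus R c \<otimes>\<^bsub>P\<^esub> p) a = poly_at R p a \<otimes> a \<ominus> c \<otimes> poly_at R p a"
  using assms
  by (simp add: x_minus_mult poly_at_add poly_at_smult poly_at_X_mult a_minus_def R.l_minus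
      del: One_nat_def)

lemma right_root_x_minus_mult:
  assumes "c \<in> carrier R" "p \<in> carrier P" "right_root R p a"
  shows "right_root R (x_minus R c \<otimes>\<^bsub>P\<^esub> p) a"
  using assms by (simp add: right_root_def poly_at_x_minus_mult a_minus_def)

text \<open>With \<open>v = p(a)\<close>, the conjugate \<open>c = v a v\<^sup>-\<^sup>1\<close> is the solution of \<open>v a - c v = 0\<close>.\<close>

lemma right_root_conjugate_x_minus_mult:
  assumes p: "p \<in> carrier P" and a: "a \<in> carrier R" and v: "poly_at R p a \<in> Units R"
  shows "right_root R
    (x_minus R (poly_at R p a \<otimes> a \<otimes> inv (poly_at R p a)) \<otimes>\<^bsub>P\<^esub> p) a"
  using assms
  by (simp add: right_root_def poly_at_x_minus_mult R.m_assoc R.r_neg a_minus_def)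

lemma right_root_x_minus:
  assumes "c \<in> carrier R"
  shows "right_root R (x_minus R c) c"
proof -
  have "poly_at R (x_minus R c \<otimes>\<^bsub>P\<^esub> \<one>\<^bsub>P\<^esub>) c = \<zero>"
    using assms by (subst poly_at_x_minus_mult) (simp_all add: poly_at_one a_minus_def R.r_neg)
  then show ?thesis
    using assms by (simp add: right_root_def)
qed

text \<open>
  The top coefficient of the product comes from \<open>x p\<close> alone, since the summand with \<open>c\<close> has
  degree at most \<open>d\<close>. Monicity of degree \<open>d\<close> is expressed by a coefficient and an upper bound,
  because the equation \<open>deg R p = d\<close> would not propagate in the zero ring, where every degree
  is \<open>0\<close>.
\<close>

lemma monic_x_minus_mult:
  assumes c: "c \<in> carrier R" and p: "p \<in> carrier P"
    and lead: "coeff P p d = \<one>" and le: "deg R p \<le> d"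
  shows "coeff P (x_minus R c \<otimes>\<^bsub>P\<^esub> p) (Suc d) = \<one>"
    and "deg R (x_minus R c \<otimes>\<^bsub>P\<^esub> p) \<le> Suc d"
proof -
  have coeff: "coeff P (x_minus R c \<otimes>\<^bsub>P\<^esub> p) (Suc k) = coeff P p k \<oplus> (\<ominus> c) \<otimes> coeff P p (Suc k)" for k
    using c p by (simp add: x_minus_mult coeff_X_mult del: coeff_mult One_nat_def)
  show "coeff P (x_minus R c \<otimes>\<^bsub>P\<^esub> p) (Suc d) = \<one>"
    using c p lead le by (simp add: coeff deg_aboveD del: coeff_mult)
  show "deg R (x_minus R c \<otimes>\<^bsub>P\<^esub> p) \<le> Suc d"
  proof (rule deg_aboveI)
    fix m assume "Suc d < m"
    then obtain k where "m = Suc k" "d < k"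
      using Suc_lessE by blast
    then show "coeff P (x_minus R c \<otimes>\<^bsub>P\<^esub> p) m = \<zero>"
      using c p le by (simp add: coeff deg_aboveD del: coeff_mult)
  qed (use c p in simp)
qed

lemma monic_x_minus:
  assumes "c \<in> carrier R"
  shows "coeff P (x_minus R c) 1 = \<one>" and "deg R (x_minus R c) \<le> 1"
  using monic_x_minus_mult[OF assms UP_one_closed, of 0] assms by simp_all

text \<open>
  Membership in the polynomial ring and monicity are part of the induction because evaluation
  and degree of the next product depend on them; the index is shifted since the recursion
  starts at \<open>1\<close>.
\<close>

lemma iter_poly_monic_right_roots:
  assumes x: "\<And>i. i \<in> {1..Suc n} \<Longrightarrow> x i \<in> carrier R"
    and unit: "\<And>i. i \<in> {1..<Suc n} \<Longrightarrow> poly_at R (iter_poly R x i) (x (i + 1)) \<in> Units R"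
  shows "iter_poly R x (Suc n) \<in> carrier P
    \<and> coeff P (iter_poly R x (Suc n)) (Suc n) = \<one> \<and> deg R (iter_poly R x (Suc n)) \<le> Suc n
    \<and> (\<forall>i\<in>{1..Suc n}. right_root R (iter_poly R x (Suc n)) (x i))"
  using assms
proof (induction n)
  case 0
  then show ?case
    using monic_x_minus[of "x 1"] right_root_x_minus[of "x 1"] by simp
next
  case (Suc n)
  define p where "p = iter_poly R x (Suc n)"
  define y where "y = x (Suc (Suc n))"
  define c where "c = poly_at R p y \<otimes> y \<otimes> inv (poly_at R p y)"
  have p: "p \<in> carrier P" "coeff P p (Suc n) = \<one>" "deg R p \<le> Suc n"
    and roots: "\<forall>i\<in>{1..Suc n}. right_root R p (x i)"
    using Suc unfolding p_def by auto
  have y: "y \<in> carrier R"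
    using Suc.prems(1)[of "Suc (Suc n)"] by (simp add: y_def)
  have v: "poly_at R p y \<in> Units R"
    using Suc.prems(2)[of "Suc n"] by (simp add: p_def y_def)
  have c: "c \<in> carrier R"
    using p y v by (simp add: c_def)
  have step: "iter_poly R x (Suc (Suc n)) = x_minus R c \<otimes>\<^bsub>P\<^esub> p"
    by (simp add: c_def p_def y_def Let_def P_def)
  have "right_root R (x_minus R c \<otimes>\<^bsub>P\<^esub> p) (x i)" if "i \<in> {1..Suc (Suc n)}" for i
  proof (cases "i = Suc (Suc n)")
    case True
    then show ?thesis
      using right_root_conjugate_x_minus_mult[OF p(1) y v] by (simp add: c_def y_def)
  next
    case False
    then show ?thesis
      using that roots c p by (intro right_root_x_minus_mult) auto
  qed
  then show ?case
    using c p monic_x_minus_mult[OF c p] by (simp only: step) simp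
qed

end

theorem theorem1:
  fixes R :: "('a, 'm) ring_scheme" and x :: "nat \<Rightarrow> 'a" and n :: nat
  assumes "ring R" and "\<one>\<^bsub>R\<^esub> \<noteq> \<zero>\<^bsub>R\<^esub>"
    and "n \<ge> 1"
    and "\<And>i. i \<in> {1..n} \<Longrightarrow> x i \<in> carrier R"
    and "inj_on x {1..n}"
    and "\<And>i. i \<in> {1..<n} \<Longrightarrow> poly_at R (iter_poly R x i) (x (i + 1)) \<in> Units R"
  shows "(\<forall>i\<in>{1..n}. poly_at R (iter_poly R x n) (x i) = \<zero>\<^bsub>R\<^esub>)
    \<and> (\<exists>P\<in>carrier (UP R). deg R P = n \<and> (\<forall>i\<in>{1..n}. right_root R P (x i)))"
proof -
  interpret UP_ring R "UP R"
    using assms(1) by (simp add: UP_ring_def)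
  have "n = Suc (n - 1)"
    using assms(3) by simp
  then have p: "iter_poly R x n \<in> carrier (UP R)"
    and lead: "coeff (UP R) (iter_poly R x n) n = \<one>\<^bsub>R\<^esub>"
    and le: "deg R (iter_poly R x n) \<le> n"
    and roots: "\<forall>i\<in>{1..n}. right_root R (iter_poly R x n) (x i)"
    using iter_poly_monic_right_roots[of "n - 1" x] assms(4,6) by metis+
  have "deg R (iter_poly R x n) = n"
    using p lead le assms(2) by (intro order_antisym deg_belowI) simp_all
  with p roots show ?thesis
    by (auto simp: right_root_def)
qed

end
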